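(* Let $F$, $D$, $d$, $e_m$, $k$, $a_i,b_i,c_i$, $\beta$, $P$, $Q$, $\gamma$ be as follows: $F:\mathbb{Z}\to\mathbb{C}$ satisfies a linear recurrence with constant coefficients of minimal order $D$ with distinct nonzero characteristic roots $r_1,\dots,r_d$ of multiplicities $e_1,\dots,e_d$; $a_i,b_i,c_i$ ($1\le i\le k$) are integers with $a_i\ge0$, $a_i+b_i\ge0$ and not both zero; $\Delta=\max_m(e_m-1)$, $\beta=1+\Delta\cdot|\{i:a_i=0\}|$, $P=\sum_i(a_i+b_i)$, $Q=\sum_ia_i$, $\gamma=\max\{0,1+\Delta(k-\sum\{a_i:a_i>0\})\}$. (i) Let $\mathcal{M}_1$ be the set of functions on $\{0,1,2,\dots\}$ of the forms $n\mapsto\prod_{\nu=1}^kF((a_\nu+b_\nu)n+i_\nu)$ and $n\mapsto n^h\prod_{\nu=1}^kF(a_\nu n+i_\nu)$ with $0\le i_\nu\le D-1$ and $0\le h\le\beta$, and let $M$ be the number of algebraically distinct formal monomials of these forms. If two linear combinations of elements of $\mathcal{M}_1$ take the same values at $n=1,2,\dots,M$, then they take the same values at every $n\in\{0,1,2,\dots\}$. (ii) The same holds with $\mathcal{M}_1$ replaced by the set $\mathcal{M}_2$ of functions $n\mapsto\prod_{\nu=1}^PF(n+i_\nu)$ and $n\mapsto n^h\prod_{\nu=1}^QF(n+i_\nu)$ ($0\le i_\nu\le D-1$, $0\le h\le\gamma$), and $M$ replaced by the number of algebraically distinct formal monomials of these forms.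
   Context: $F$ is extended to all integers by its closed form $F(n)=\sum_m\sum_{h<e_m}\lambda_{m,h}n^hr_m^n$. A formal monomial is an expression $n^h\prod_\nu F(\alpha_\nu n+i_\nu)$; factors with $\alpha_\nu=0$ are constants $F(i_\nu)$. Two formal monomials are algebraically equivalent ("not algebraically distinct") if they differ only by a rearrangement of factors or by a constant factor arising from factors with $\alpha_\nu=0$ (i.e. from $a_\nu+b_\nu=0$ or $a_\nu=0$). *)

theory Defs
  imports Complex_Main "HOL-Library.Multiset" "HOL-Computational_Algebra.Polynomial"
begin

text \<open>
  \<open>linear_recurrence F D p\<close>: on \<open>{0,1,2,\<dots>}\<close> the sequence \<open>F\<close> satisfies the order-\<open>D\<close> recurrence
  with constant coefficients whose (monic) characteristic polynomial is \<open>p\<close>, that is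
  \<open>F(n+D) = - (\<Sum>j<D. p\<^sub>j F(n+j))\<close>. Orders are positive, so the zero sequence has
  minimal order 1.
\<close>
definition linear_recurrence :: "(int \<Rightarrow> complex) \<Rightarrow> nat \<Rightarrow> complex poly \<Rightarrow> bool" where
  "linear_recurrence F D p \<longleftrightarrow>
     D > 0 \<and> degree p = D \<and> lead_coeff p = 1 \<and>
     (\<forall>n::nat. (\<Sum>j\<le>D. coeff p j * F (int n + int j)) = 0)"

text \<open>
  The pair \<open>(h, [(\<alpha>\<^sub>1,i\<^sub>1),\<dots>,(\<alpha>\<^sub>s,i\<^sub>s)])\<close> stands for the expression
  \<open>n^h * F(\<alpha>\<^sub>1 n + i\<^sub>1) * \<dots> * F(\<alpha>\<^sub>s n + i\<^sub>s)\<close>.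
\<close>
type_synonym formal_monomial = "nat \<times> (int \<times> int) list"

definition monomial_fun :: "(int \<Rightarrow> complex) \<Rightarrow> formal_monomial \<Rightarrow> nat \<Rightarrow> complex" where
  "monomial_fun F t n =
     of_nat n ^ fst t * (\<Prod>(\<alpha>, i)\<leftarrow>snd t. F (\<alpha> * int n + i))"

text \<open>
  Factors with \<open>\<alpha> = 0\<close> are constants and are disregarded; the order of the remaining
  factors is disregarded as well. Nothing about the values of \<open>F\<close> enters.
\<close>
definition alg_equiv :: "(formal_monomial \<times> formal_monomial) set" where
  "alg_equiv = {(s, t). fst s = fst t \<and>
     mset (filter (\<lambda>(\<alpha>, i). \<alpha> \<noteq> 0) (snd s)) = mset (filter (\<lambda>(\<alpha>, i). \<alpha> \<noteq> 0) (snd t))}"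

lemma equiv_alg_equiv: "equiv UNIV alg_equiv"
  by (auto simp: alg_equiv_def equiv_def refl_on_def sym_def trans_def)

definition num_alg_distinct :: "formal_monomial set \<Rightarrow> nat" where
  "num_alg_distinct S = card (S // alg_equiv)"

definition monomials :: "nat \<Rightarrow> nat \<Rightarrow> nat \<Rightarrow> (nat \<Rightarrow> int) \<Rightarrow> formal_monomial set" where
  "monomials D h s \<alpha> =
     {(h, map (\<lambda>\<nu>. (\<alpha> \<nu>, i \<nu>)) [1..<Suc s]) | i.
        \<forall>\<nu>\<in>{1..s}. 0 \<le> i \<nu> \<and> i \<nu> \<le> int D - 1}"

definition formal_M1 ::
  "nat \<Rightarrow> nat \<Rightarrow> (nat \<Rightarrow> int) \<Rightarrow> (nat \<Rightarrow> int) \<Rightarrow> nat \<Rightarrow> formal_monomial set" where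
  "formal_M1 D k a b \<beta> =
     monomials D 0 k (\<lambda>\<nu>. a \<nu> + b \<nu>) \<union> (\<Union>h\<in>{0..\<beta>}. monomials D h k a)"

definition formal_M2 :: "nat \<Rightarrow> nat \<Rightarrow> nat \<Rightarrow> nat \<Rightarrow> formal_monomial set" where
  "formal_M2 D P Q \<gamma> =
     monomials D 0 P (\<lambda>\<nu>. 1) \<union> (\<Union>h\<in>{0..\<gamma>}. monomials D h Q (\<lambda>\<nu>. 1))"

definition M1 ::
  "(int \<Rightarrow> complex) \<Rightarrow> nat \<Rightarrow> nat \<Rightarrow> (nat \<Rightarrow> int) \<Rightarrow> (nat \<Rightarrow> int) \<Rightarrow> nat \<Rightarrow> (nat \<Rightarrow> complex) set" where
  "M1 F D k a b \<beta> = monomial_fun F ` formal_M1 D k a b \<beta>"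

definition M2 ::
  "(int \<Rightarrow> complex) \<Rightarrow> nat \<Rightarrow> nat \<Rightarrow> nat \<Rightarrow> nat \<Rightarrow> (nat \<Rightarrow> complex) set" where
  "M2 F D P Q \<gamma> = monomial_fun F ` formal_M2 D P Q \<gamma>"

definition linear_combinations :: "(nat \<Rightarrow> complex) set \<Rightarrow> (nat \<Rightarrow> complex) set" where
  "linear_combinations S =
     {(\<lambda>n. \<Sum>f\<in>T. w f * f n) | T w. finite T \<and> T \<subseteq> S}"

end

theory Submission
  imports Defs "HOL-Library.Function_Algebras" "HOL-Library.FuncSet"
begin

text \<open>
  Either span of monomials, regarded as a space of functions on \<open>\<int>\<close>, is mapped into itself by
  the shift \<open>n \<mapsto> n + 1\<close>: a factor \<open>F(\<alpha>n + \<alpha> + i)\<close> is reduced to the factors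
  \<open>F(\<alpha>n + j)\<close> with \<open>j < D\<close> by the recurrence, and \<open>(n + 1)^h\<close> expands into lower powers.
  Equivalent monomials are multiples of one function, so the span has dimension at most \<open>M\<close>
  and \<open>M + 1\<close> successive shifts of an element \<open>f\<close> are linearly dependent. The first and last
  nonzero coefficients of this dependence turn it into a recurrence for \<open>f\<close> on \<open>\<int>\<close> of order
  at most \<open>M\<close> that can be run forwards and backwards, so \<open>f\<close> vanishes if it does at \<open>1, \<dots>, M\<close>.
\<close>

section \<open>Functions into a field as a vector space\<close>

interpretation fun_space: vector_space "\<lambda>(c::'a::field) (f::'b \<Rightarrow> 'a) x. c * f x"
  by unfold_locales (auto simp: fun_eq_iff algebra_simps)

lemma sum_fun_apply: "(\<Sum>i\<in>A. f i) x = (\<Sum>i\<in>A. f i x)"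
  for f :: "'a \<Rightarrow> 'b \<Rightarrow> 'c::comm_monoid_add"
  by (induction A rule: infinite_finite_induct) auto

section \<open>Shift operators\<close>

text \<open>This is \<open>p(E) f\<close> for the shift operator \<open>E f n = f (n + 1)\<close>.
  The domain is \<int>, so that relations can be evaluated at negative arguments.\<close>

definition shift_poly :: "'a::comm_ring_1 poly \<Rightarrow> (int \<Rightarrow> 'a) \<Rightarrow> int \<Rightarrow> 'a" where
  "shift_poly p f n = (\<Sum>j\<le>degree p. coeff p j * f (n + int j))"

lemma shift_poly_bound:
  assumes "degree p \<le> N"
  shows "shift_poly p f n = (\<Sum>j\<le>N. coeff p j * f (n + int j))"
  unfolding shift_poly_def
  by (rule sum.mono_neutral_left) (use assms in \<open>auto simp: coeff_eq_0\<close>)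

lemma shift_poly_0 [simp]: "shift_poly 0 f n = 0"
  by (simp add: shift_poly_def)

lemma shift_poly_pCons: "shift_poly (pCons c p) f n = c * f n + shift_poly p f (n + 1)"
proof -
  have "shift_poly (pCons c p) f n
      = (\<Sum>j\<le>Suc (degree p). coeff (pCons c p) j * f (n + int j))"
    by (rule shift_poly_bound) (rule degree_pCons_le)
  also have "\<dots> = c * f n + (\<Sum>j\<le>degree p. coeff p j * f (n + 1 + int j))"
    by (subst sum.atMost_Suc_shift) (simp add: algebra_simps)
  finally show ?thesis by (simp add: shift_poly_def)
qed

lemma shift_poly_add: "shift_poly (p + q) f n = shift_poly p f n + shift_poly q f n"
proof -
  let ?N = "max (degree p) (degree q)"
  have "degree (p + q) \<le> ?N" by (rule degree_add_le_max)
  then show ?thesis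
    by (simp add: shift_poly_bound[of _ ?N] sum.distrib algebra_simps)
qed

lemma shift_poly_smult: "shift_poly (smult c p) f n = c * shift_poly p f n"
  by (simp add: shift_poly_bound[OF degree_smult_le])
     (simp add: shift_poly_def sum_distrib_left mult.assoc)

text \<open>Since polynomials commute, this shows that whatever one factor annihilates is
  annihilated by the whole product.\<close>

lemma shift_poly_mult: "shift_poly (p * q) f n = shift_poly p (shift_poly q f) n"
proof (induction p arbitrary: n)
  case (pCons c p)
  then show ?case
    by (simp add: mult_pCons_left shift_poly_add shift_poly_smult shift_poly_pCons)
qed simp

lemma shift_poly_sum:
  "shift_poly p (\<lambda>n. \<Sum>i\<in>A. c i * f i n) n = (\<Sum>i\<in>A. c i * shift_poly p (f i) n)"
  unfolding shift_poly_def sum_distrib_left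
  by (subst sum.swap) (simp add: algebra_simps)

lemma shift_poly_zero_fun: "shift_poly p (\<lambda>n. 0) n = 0"
  by (simp add: shift_poly_def)

text \<open>\<open>E - r\<close> turns \<open>n^h r^n\<close> into
  \<open>r ((n+1)^h - n^h) r^n\<close>, where only powers of \<open>n\<close> below \<open>h\<close>
  survive, so \<open>e > h\<close> applications leave nothing.\<close>

lemma shift_poly_power_root:
  fixes r :: "'a::field"
  assumes "r \<noteq> 0" "h < e"
  shows "shift_poly ([:- r, 1:] ^ e) (\<lambda>n. of_int n ^ h * r powi n) n = 0"
  using assms(2)
proof (induction e arbitrary: h n)
  case (Suc e)
  have step: "shift_poly [:- r, 1:] (\<lambda>n. of_int n ^ h * r powi n)
      = (\<lambda>n. \<Sum>l<h. (r * of_nat (h choose l)) * (of_int n ^ l * r powi n))"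
  proof
    fix n
    have "(of_int n + 1 :: 'a) ^ h = (\<Sum>l\<le>h. of_nat (h choose l) * of_int n ^ l)"
      by (simp add: binomial_ring)
    also have "\<dots> = (\<Sum>l<h. of_nat (h choose l) * of_int n ^ l) + of_int n ^ h"
      by (simp add: lessThan_Suc_atMost[symmetric])
    finally have binom:
      "(of_int n + 1 :: 'a) ^ h = (\<Sum>l<h. of_nat (h choose l) * of_int n ^ l) + of_int n ^ h" .
    \<comment> \<open>For \<open>r = 0\<close> this would fail at \<open>n = -1\<close>, where the
      left side is \<open>0 powi 0 = 1\<close>.\<close>
    have powi: "r powi (n + 1) = r * r powi n"
      using assms(1) by (simp add: power_int_add_1 mult.commute)
    show "shift_poly [:- r, 1:] (\<lambda>n. of_int n ^ h * r powi n) n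
        = (\<Sum>l<h. (r * of_nat (h choose l)) * (of_int n ^ l * r powi n))"
      by (simp add: shift_poly_pCons binom powi sum_distrib_left distrib_left distrib_right
            sum_distrib_right) (simp add: mult_ac)
  qed
  have "shift_poly ([:- r, 1:] ^ Suc e) (\<lambda>n. of_int n ^ h * r powi n) n
      = shift_poly ([:- r, 1:] ^ e)
          (\<lambda>n. \<Sum>l<h. (r * of_nat (h choose l)) * (of_int n ^ l * r powi n)) n"
    by (simp only: power_Suc2 shift_poly_mult step)
  also have "\<dots> = 0"
    using Suc by (simp only: shift_poly_sum) (auto intro!: sum.neutral)
  finally show ?case .
qed simp

lemma shift_poly_exponential_polynomial:
  fixes r :: "'i \<Rightarrow> 'a::field"
  assumes "finite A" "\<And>m. m \<in> A \<Longrightarrow> r m \<noteq> 0"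
  shows "shift_poly (\<Prod>m\<in>A. [:- r m, 1:] ^ e m)
    (\<lambda>n. \<Sum>m\<in>A. \<Sum>h<e m. lam m h * of_int n ^ h * r m powi n) n = 0"
proof -
  let ?p = "\<Prod>m\<in>A. [:- r m, 1:] ^ e m"
  have "shift_poly ?p (\<lambda>n. of_int n ^ h * r m powi n) n = 0" if "m \<in> A" "h < e m" for m h n
  proof -
    \<comment> \<open>The factor belonging to \<open>m\<close> is moved to the right so that it acts
      first; it already kills the summand.\<close>
    have "?p = (\<Prod>m\<in>A - {m}. [:- r m, 1:] ^ e m) * [:- r m, 1:] ^ e m"
      using assms(1) that(1) by (simp add: prod.remove mult.commute)
    moreover have "shift_poly ([:- r m, 1:] ^ e m) (\<lambda>n. of_int n ^ h * r m powi n) = (\<lambda>n. 0)"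
      using shift_poly_power_root[OF assms(2)[OF that(1)] that(2)] by auto
    ultimately show ?thesis
      by (simp add: shift_poly_mult shift_poly_zero_fun)
  qed
  then have "shift_poly ?p (\<lambda>n. \<Sum>(m, h)\<in>Sigma A (\<lambda>m. {..<e m}).
      lam m h * (of_int n ^ h * r m powi n)) n = 0"
    unfolding case_prod_unfold by (subst shift_poly_sum) (auto intro!: sum.neutral)
  then show ?thesis
    using assms(1) by (simp add: sum.Sigma mult.assoc)
qed

section \<open>Zeros of a function whose shifts span a finite-dimensional space\<close>

text \<open>A relation among the shifts \<open>0..M\<close> holds at every integer, but which of its
  coefficients are nonzero is unknown. The extreme nonzero positions \<open>i\<close> and
  \<open>L\<close> suffice: solving for the term at \<open>L\<close> carries zeros upward, solving
  for the term at \<open>i\<close> carries them down to 0.\<close>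

lemma vanishing_of_shifts_in_span:
  fixes f :: "int \<Rightarrow> 'a::field"
  assumes B: "finite B" "card B \<le> M"
    and shifts: "\<And>j. (\<lambda>n. f (n + int j)) \<in> fun_space.span B"
    and zero: "\<And>m. 1 \<le> m \<Longrightarrow> m \<le> int M \<Longrightarrow> f m = 0"
  shows "f (int n) = 0"
proof -
  define g where "g j = (\<lambda>n. f (n + int j))" for j
  obtain c where c: "\<exists>j\<le>M. c j \<noteq> 0" "\<And>n. (\<Sum>j\<le>M. c j * f (n + int j)) = 0"
  \<comment> \<open>Dependence is a property of the set of shifts. If two shifts coincide, this set
    may be too small to be dependent, but their difference is then itself the relation
    sought.\<close>
  proof (cases "inj_on g {..M}")
    case True
    have "fun_space.dependent (g ` {..M})"
    proof (rule ccontr)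
      assume "fun_space.independent (g ` {..M})"
      moreover have "g ` {..M} \<subseteq> fun_space.span B"
        using shifts by (auto simp: g_def)
      ultimately have "card (g ` {..M}) \<le> card B"
        using fun_space.independent_span_bound[OF B(1)] by blast
      then show False
        using B(2) by (simp add: card_image[OF True])
    qed
    then obtain u where u: "\<exists>v\<in>g ` {..M}. u v \<noteq> 0"
        "(\<Sum>v\<in>g ` {..M}. (\<lambda>x. u v * v x)) = 0"
      by (auto simp: fun_space.dependent_finite)
    show ?thesis
    proof (rule that[of "\<lambda>j. u (g j)"])
      show "\<exists>j\<le>M. u (g j) \<noteq> 0" using u(1) by auto
      show "(\<Sum>j\<le>M. u (g j) * f (n + int j)) = 0" for n
        using fun_cong[OF u(2), of n]
        by (simp add: sum_fun_apply sum.reindex[OF True]) (simp add: g_def)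
    qed
  next
    case False
    then obtain i j where ij: "i \<le> M" "j \<le> M" "i \<noteq> j" "g i = g j"
      by (auto simp: inj_on_def)
    have eq: "f (n + int i) = f (n + int j)" for n
      using fun_cong[OF ij(4), of n] by (simp add: g_def)
    show ?thesis
    proof (rule that[of "\<lambda>l. of_bool (l = i) - of_bool (l = j)"])
      show "\<exists>l\<le>M. (of_bool (l = i) - of_bool (l = j) :: 'a) \<noteq> 0"
        using ij by (intro exI[of _ i]) auto
      show "(\<Sum>l\<le>M. (of_bool (l = i) - of_bool (l = j)) * f (n + int l)) = 0" for n
        using ij(1,2) eq[of n] by (simp add: left_diff_distrib sum_subtractf)
    qed
  qed
  define N where "N = {j. j \<le> M \<and> c j \<noteq> 0}"
  have N: "finite N" "N \<noteq> {}" using c(1) by (auto simp: N_def)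
  define i L where "i = Min N" and "L = Max N"
  have iL: "i \<in> N" "L \<in> N" "\<And>j. j \<in> N \<Longrightarrow> i \<le> j \<and> j \<le> L"
    using N by (simp_all add: i_def L_def)
  have coeff0: "c j = 0" if "j \<le> M" "j < i \<or> L < j" for j
    by (rule ccontr) (use iL(3)[of j] that in \<open>auto simp: N_def\<close>)
  \<comment> \<open>Outside \<open>i..L\<close> the coefficients vanish. If the other terms vanish
    as well, only \<open>c l * f (n + int l)\<close> remains, with
    \<open>c l \<noteq> 0\<close>.\<close>
  have isolate: "f (n + int l) = 0"
    if "l \<in> N" "\<And>j. j \<le> M \<Longrightarrow> j \<noteq> l \<Longrightarrow> i \<le> j \<Longrightarrow> j \<le> L \<Longrightarrow> f (n + int j) = 0" for l n
  proof -
    have "(\<Sum>j\<le>M. c j * f (n + int j)) = (\<Sum>j\<in>{l}. c j * f (n + int j))"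
      using that coeff0 by (intro sum.mono_neutral_right) (auto simp: N_def not_le[symmetric])
    then show ?thesis
      using c(2)[of n] that(1) by (simp add: N_def)
  qed
  have forward: "f (int m) = 0" if "m \<ge> 1" for m
    using that
  proof (induction m rule: less_induct)
    case (less m)
    show ?case
    proof (cases "m \<le> M")
      case False
      have "L \<le> M" using iL(2) by (simp add: N_def)
      \<comment> \<open>\<open>L \<le> M < m\<close> puts every argument \<open>m - L + j\<close>
        with \<open>j < L\<close> between 1 and \<open>m - 1\<close>, where the induction hypothesis
        applies.\<close>
      have "f (int (m - L) + int L) = 0"
      proof (rule isolate[OF iL(2)])
        fix j assume "j \<noteq> L" "j \<le> L"
        then have "f (int (m - L + j)) = 0"
          using False \<open>L \<le> M\<close> by (intro less.IH) auto
        then show "f (int (m - L) + int j) = 0" by simp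
      qed
      then show ?thesis using False \<open>L \<le> M\<close> by (simp add: of_nat_diff)
    qed (use zero less.prems in auto)
  qed
  \<comment> \<open>With base point \<open>- i\<close> the index \<open>i\<close> falls on 0 and all
    later ones on positive arguments. The base point can be negative, hence the passage to functions
    on \<int>.\<close>
  have "f (- int i + int i) = 0"
  proof (rule isolate[OF iL(1)])
    fix j assume "j \<noteq> i" "i \<le> j"
    then show "f (- int i + int j) = 0"
      using forward[of "j - i"] by (simp add: of_nat_diff)
  qed
  then show ?thesis
    using forward[of n] by (cases n) auto
qed

section \<open>Monomials as functions on the integers\<close>

definition monomial_int :: "(int \<Rightarrow> complex) \<Rightarrow> formal_monomial \<Rightarrow> int \<Rightarrow> complex" where
  "monomial_int F t n = of_int n ^ fst t * (\<Prod>(\<alpha>, i)\<leftarrow>snd t. F (\<alpha> * n + i))"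

lemma monomial_fun_eq: "monomial_fun F t n = monomial_int F t (int n)"
  by (simp add: monomial_fun_def monomial_int_def)

text \<open>The order of the remaining factors is kept, so equivalent monomials may have different
  varying parts; only the functions these define agree.\<close>

definition varying_part :: "formal_monomial \<Rightarrow> formal_monomial" where
  "varying_part t = (fst t, filter (\<lambda>(\<alpha>, i). \<alpha> \<noteq> 0) (snd t))"

text \<open>The constant factor may be 0, so monomials lie in the span of the functions of their
  varying parts, but not necessarily conversely.\<close>

lemma monomial_int_varying_part:
  "monomial_int F t n = (\<Prod>(\<alpha>, i)\<leftarrow>filter (\<lambda>(\<alpha>, i). \<alpha> = 0) (snd t). F i) *
     monomial_int F (varying_part t) n"
proof -
  have "(\<Prod>(\<alpha>, i)\<leftarrow>xs. F (\<alpha> * n + i)) = (\<Prod>(\<alpha>, i)\<leftarrow>filter (\<lambda>(\<alpha>, i). \<alpha> = 0) xs. F i) *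
     (\<Prod>(\<alpha>, i)\<leftarrow>filter (\<lambda>(\<alpha>, i). \<alpha> \<noteq> 0) xs. F (\<alpha> * n + i))" for xs
    by (induction xs) (simp_all add: case_prod_unfold mult.left_commute)
  from this[of "snd t"] show ?thesis
    by (simp add: monomial_int_def varying_part_def)
qed

lemma monomial_int_varying_part_cong:
  assumes "(s, t) \<in> alg_equiv"
  shows "monomial_int F (varying_part s) = monomial_int F (varying_part t)"
proof
  fix n
  have "mset (map (\<lambda>(\<alpha>, i). F (\<alpha> * n + i)) (snd (varying_part s)))
      = mset (map (\<lambda>(\<alpha>, i). F (\<alpha> * n + i)) (snd (varying_part t)))"
    using assms by (simp add: alg_equiv_def varying_part_def)
  then have "prod_list (map (\<lambda>(\<alpha>, i). F (\<alpha> * n + i)) (snd (varying_part s)))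
      = prod_list (map (\<lambda>(\<alpha>, i). F (\<alpha> * n + i)) (snd (varying_part t)))"
    by (metis prod_mset_prod_list)
  then show "monomial_int F (varying_part s) n = monomial_int F (varying_part t) n"
    using assms by (simp add: monomial_int_def varying_part_def alg_equiv_def)
qed

lemma card_varying_parts_le:
  assumes "finite S"
  shows "card ((\<lambda>t. monomial_int F (varying_part t)) ` S) \<le> num_alg_distinct S"
proof -
  let ?g = "\<lambda>t. monomial_int F (varying_part t)"
  \<comment> \<open>\<open>?g\<close> is an invariant of the class, so any representative will do,
    even one outside \<open>S\<close>.\<close>
  have "?g t \<in> (\<lambda>C. ?g (SOME s. s \<in> C)) ` (S // alg_equiv)" if "t \<in> S" for t
  proof
    show "alg_equiv `` {t} \<in> S // alg_equiv" using that by (rule quotientI)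
    have "t \<in> alg_equiv `` {t}" by (simp add: alg_equiv_def)
    then have "(SOME s. s \<in> alg_equiv `` {t}) \<in> alg_equiv `` {t}" by (rule someI)
    then show "?g t = ?g (SOME s. s \<in> alg_equiv `` {t})"
      by (intro monomial_int_varying_part_cong) simp
  qed
  moreover have "finite (S // alg_equiv)"
    using assms by (simp add: quotient_def)
  ultimately show ?thesis
    unfolding num_alg_distinct_def by (intro surj_card_le) auto
qed

lemma monomial_int_in_span_varying_parts:
  assumes "t \<in> S"
  shows "monomial_int F t \<in> fun_space.span ((\<lambda>t. monomial_int F (varying_part t)) ` S)"
proof -
  have "monomial_int F t = (\<lambda>n. (\<Prod>(\<alpha>, i)\<leftarrow>filter (\<lambda>(\<alpha>, i). \<alpha> = 0) (snd t). F i) *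
      monomial_int F (varying_part t) n)"
    by (rule ext) (rule monomial_int_varying_part)
  also have "\<dots> \<in> fun_space.span ((\<lambda>t. monomial_int F (varying_part t)) ` S)"
    using assms by (intro fun_space.span_scale fun_space.span_base imageI)
  finally show ?thesis .
qed

lemma linear_combinations_lift:
  assumes "f \<in> linear_combinations (monomial_fun F ` S)"
  obtains f' where "f' \<in> fun_space.span (monomial_int F ` S)" "\<And>n. f' (int n) = f n"
proof -
  obtain T w where T: "T \<subseteq> monomial_fun F ` S" "f = (\<lambda>n. \<Sum>u\<in>T. w u * u n)"
    using assms by (auto simp: linear_combinations_def)
  \<comment> \<open>Different formal monomials can give the same function on \<nat>, so one of them
    is fixed for each \<open>u\<close>.\<close>
  from T(1) have "\<forall>u\<in>T. \<exists>t. t \<in> S \<and> monomial_fun F t = u" by blast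
  from bchoice[OF this] obtain t where t: "\<And>u. u \<in> T \<Longrightarrow> t u \<in> S"
      "\<And>u. u \<in> T \<Longrightarrow> monomial_fun F (t u) = u"
    by blast
  show ?thesis
  proof (rule that)
    show "(\<Sum>u\<in>T. (\<lambda>x. w u * monomial_int F (t u) x)) \<in> fun_space.span (monomial_int F ` S)"
      using t by (intro fun_space.span_sum fun_space.span_scale fun_space.span_base) auto
    show "(\<Sum>u\<in>T. (\<lambda>x. w u * monomial_int F (t u) x)) (int n) = f n" for n
      unfolding sum_fun_apply T(2)
      by (intro sum.cong refl) (simp add: monomial_fun_eq[symmetric] t(2))
  qed
qed

text \<open>Shift-invariance of the span puts all shifts of the difference of two lifts into a space
  of dimension at most \<open>num_alg_distinct S\<close>, so the vanishing criterion applies to that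
  difference.\<close>

lemma linear_combinations_eqI:
  assumes "finite S"
    and shift: "\<And>t. t \<in> S \<Longrightarrow>
      (\<lambda>n. monomial_int F t (n + 1)) \<in> fun_space.span (monomial_int F ` S)"
    and f: "f \<in> linear_combinations (monomial_fun F ` S)"
    and g: "g \<in> linear_combinations (monomial_fun F ` S)"
    and eq: "\<And>n. n \<in> {1..num_alg_distinct S} \<Longrightarrow> f n = g n"
  shows "f n = g n"
proof -
  let ?V = "fun_space.span (monomial_int F ` S)"
  let ?B = "(\<lambda>t. monomial_int F (varying_part t)) ` S"
  obtain f' where f': "f' \<in> ?V" "\<And>n. f' (int n) = f n"
    using f by (rule linear_combinations_lift) blast
  obtain g' where g': "g' \<in> ?V" "\<And>n. g' (int n) = g n"
    using g by (rule linear_combinations_lift) blast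
  have shift_span: "(\<lambda>n. u (n + 1)) \<in> ?V" if "u \<in> ?V" for u
    using that
  proof (induction u rule: fun_space.span_induct_alt)
    case base
    show ?case using fun_space.span_zero by (simp add: zero_fun_def)
  next
    case (step c x y)
    have "(\<lambda>n. c * x (n + 1)) + (\<lambda>n. y (n + 1)) \<in> ?V"
      using step shift by (intro fun_space.span_add fun_space.span_scale) auto
    then show ?case by (simp add: plus_fun_def)
  qed
  define u where "u = f' - g'"
  have "(\<lambda>n. u (n + int j)) \<in> ?V" for j
  proof (induction j)
    case 0
    have "u \<in> ?V" unfolding u_def using f'(1) g'(1) by (rule fun_space.span_diff)
    then show ?case by simp
  next
    case (Suc j)
    from shift_span[OF this] show ?case by (simp add: algebra_simps)
  qed
  \<comment> \<open>Shift-invariance is known for \<open>?V\<close>, the bound on the number of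
    generators for \<open>?B\<close>; this inclusion joins the two.\<close>
  moreover have "?V \<subseteq> fun_space.span ?B"
    using monomial_int_in_span_varying_parts
    by (intro fun_space.span_minimal fun_space.subspace_span) auto
  ultimately have "(\<lambda>n. u (n + int j)) \<in> fun_space.span ?B" for j by blast
  moreover have "u m = 0" if m: "1 \<le> m" "m \<le> int (num_alg_distinct S)" for m
  proof -
    obtain k where "m = int k" using m(1) zero_le_imp_eq_int[of m] by auto
    then show ?thesis using m eq[of k] by (simp add: u_def f'(2) g'(2))
  qed
  ultimately have "u (int n) = 0"
    by (rule vanishing_of_shifts_in_span[OF finite_imageI[OF assms(1)]
          card_varying_parts_le[OF assms(1)]])
  then show ?thesis by (simp add: u_def f'(2) g'(2))
qed

section \<open>Closure of the monomial spans under the shift\<close>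

lemma finite_monomials: "finite (monomials D h s \<alpha>)"
proof -
  have "monomials D h s \<alpha> \<subseteq> (\<lambda>i. (h, map (\<lambda>\<nu>. (\<alpha> \<nu>, i \<nu>)) [1..<Suc s])) `
      ({1..s} \<rightarrow>\<^sub>E {0..int D - 1})"
  proof
    fix t assume "t \<in> monomials D h s \<alpha>"
    then obtain i where i: "t = (h, map (\<lambda>\<nu>. (\<alpha> \<nu>, i \<nu>)) [1..<Suc s])"
        "\<forall>\<nu>\<in>{1..s}. 0 \<le> i \<nu> \<and> i \<nu> \<le> int D - 1"
      by (auto simp: monomials_def)
    show "t \<in> (\<lambda>i. (h, map (\<lambda>\<nu>. (\<alpha> \<nu>, i \<nu>)) [1..<Suc s])) ` ({1..s} \<rightarrow>\<^sub>E {0..int D - 1})"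
      \<comment> \<open>Values of \<open>i\<close> outside \<open>{1..s}\<close> do not enter the
        list, so restricting \<open>i\<close> leaves the monomial unchanged.\<close>
      using i by (intro image_eqI[of _ _ "restrict i {1..s}"]) auto
  qed
  then show ?thesis
    by (rule finite_subset) (intro finite_imageI finite_PiE, auto)
qed

lemma monomial_int_map:
  "monomial_int F (h, map (\<lambda>\<nu>. (\<alpha> \<nu>, i \<nu>)) [1..<Suc s]) n
     = of_int n ^ h * (\<Prod>\<nu>\<in>{1..s}. F (\<alpha> \<nu> * n + i \<nu>))"
  by (simp add: monomial_int_def o_def prod.distinct_set_conv_list[symmetric]
        atLeastLessThanSuc_atLeastAtMost del: upt_Suc)

text \<open>The monic recurrence expresses each offset \<open>j \<ge> degree p\<close> through the
  preceding ones. It matters that \<open>\<kappa>\<close> does not depend on \<open>m\<close>: with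
  \<open>m = \<alpha> n\<close> the same coefficients then serve for all \<open>n\<close>.\<close>

lemma recurrence_reduce:
  fixes F :: "int \<Rightarrow> complex"
  assumes "lead_coeff p = 1" "degree p > 0" "\<And>n. shift_poly p F n = 0"
  shows "\<exists>\<kappa>. \<forall>m. F (m + int j) = (\<Sum>i<degree p. \<kappa> i * F (m + int i))"
proof (induction j rule: less_induct)
  case (less j)
  let ?D = "degree p"
  show ?case
  proof (cases "j < ?D")
    case True
    then show ?thesis
      by (intro exI[of _ "\<lambda>i. of_bool (i = j)"]) simp
  next
    case False
    have "\<forall>i\<in>{..<?D}. \<exists>\<kappa>. \<forall>m. F (m + int (j - ?D + i)) = (\<Sum>l<?D. \<kappa> l * F (m + int l))"
      using False by (intro ballI less.IH) auto
    then obtain \<kappa> where \<kappa>: "\<And>i m. i < ?D \<Longrightarrow>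
        F (m + int (j - ?D + i)) = (\<Sum>l<?D. \<kappa> i l * F (m + int l))"
      by (metis lessThan_iff)
    have "F (m + int j) = (\<Sum>l<?D. (\<Sum>i<?D. - coeff p i * \<kappa> i l) * F (m + int l))" for m
    proof -
      \<comment> \<open>The recurrence is placed so that its top term is
        \<open>F (m + int j)\<close>.\<close>
      have "0 = shift_poly p F (m + int (j - ?D))" using assms(3) by simp
      also have "\<dots> = (\<Sum>i<?D. coeff p i * F (m + int (j - ?D + i))) + F (m + int j)"
        using assms(1) False
        by (simp add: shift_poly_def lessThan_Suc_atMost[symmetric] of_nat_diff algebra_simps)
      also have "(\<Sum>i<?D. coeff p i * F (m + int (j - ?D + i)))
          = (\<Sum>i<?D. coeff p i * (\<Sum>l<?D. \<kappa> i l * F (m + int l)))"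
        using \<kappa> by (intro sum.cong) auto
      also have "\<dots> = (\<Sum>l<?D. (\<Sum>i<?D. coeff p i * \<kappa> i l) * F (m + int l))"
        unfolding sum_distrib_left sum_distrib_right by (subst sum.swap) (simp add: mult.assoc)
      finally show ?thesis
        by (simp add: sum_negf eq_neg_iff_add_eq_0 add.commute)
    qed
    then show ?thesis
      by (intro exI[of _ "\<lambda>l. \<Sum>i<?D. - coeff p i * \<kappa> i l"] allI)
  qed
qed

text \<open>Each shifted factor has offset \<open>\<alpha> \<nu> + i \<nu> \<ge> 0\<close>, which
  the recurrence reduces to offsets below \<open>D\<close>. Multiplying out, together with the
  binomial expansion of \<open>(n + 1)^h\<close>, yields monomials with the same
  \<open>\<alpha>\<close> and exponents at most \<open>h\<close>.\<close>

lemma monomial_int_shift_in_span: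
  assumes red: "\<And>j::nat. \<exists>\<kappa>. \<forall>m. F (m + int j) = (\<Sum>i<D. \<kappa> i * F (m + int i))"
    and \<alpha>: "\<And>\<nu>. \<nu> \<in> {1..s} \<Longrightarrow> \<alpha> \<nu> \<ge> 0"
    and t: "t \<in> monomials D h s \<alpha>"
    and S: "\<And>l. l \<le> h \<Longrightarrow> monomials D l s \<alpha> \<subseteq> S"
  shows "(\<lambda>n. monomial_int F t (n + 1)) \<in> fun_space.span (monomial_int F ` S)"
proof -
  obtain i where i: "t = (h, map (\<lambda>\<nu>. (\<alpha> \<nu>, i \<nu>)) [1..<Suc s])"
      "\<And>\<nu>. \<nu> \<in> {1..s} \<Longrightarrow> 0 \<le> i \<nu>"
    using t unfolding monomials_def by blast
  obtain \<kappa> where \<kappa>: "\<And>j m. F (m + int j) = (\<Sum>l<D. \<kappa> j l * F (m + int l))"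
    using red by metis
  \<comment> \<open>A function \<open>\<phi>\<close> in \<open>?J\<close> picks one reduced offset
    per factor; \<open>C \<phi>\<close> and \<open>\<mu> l \<phi>\<close> are the coefficient and
    the monomial which that choice contributes.\<close>
  let ?J = "{1..s} \<rightarrow>\<^sub>E {..<D}"
  define C where "C \<phi> = (\<Prod>\<nu>\<in>{1..s}. \<kappa> (nat (\<alpha> \<nu> + i \<nu>)) (\<phi> \<nu>))" for \<phi>
  define \<mu> where "\<mu> l \<phi> = (l, map (\<lambda>\<nu>. (\<alpha> \<nu>, int (\<phi> \<nu>))) [1..<Suc s])" for l :: nat and \<phi>
  have "(\<lambda>n. monomial_int F t (n + 1))
      = (\<Sum>(l, \<phi>)\<in>{..h} \<times> ?J. (\<lambda>n. (of_nat (h choose l) * C \<phi>) * monomial_int F (\<mu> l \<phi>) n))"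
  proof
    fix n
    have "F (\<alpha> \<nu> * (n + 1) + i \<nu>)
        = (\<Sum>l<D. \<kappa> (nat (\<alpha> \<nu> + i \<nu>)) l * F (\<alpha> \<nu> * n + int l))" if "\<nu> \<in> {1..s}" for \<nu>
      using \<kappa>[of "\<alpha> \<nu> * n" "nat (\<alpha> \<nu> + i \<nu>)"] \<alpha>[OF that] i(2)[OF that]
      by (simp add: algebra_simps)
    then have "(\<Prod>\<nu>\<in>{1..s}. F (\<alpha> \<nu> * (n + 1) + i \<nu>))
        = (\<Prod>\<nu>\<in>{1..s}. \<Sum>l<D. \<kappa> (nat (\<alpha> \<nu> + i \<nu>)) l * F (\<alpha> \<nu> * n + int l))"
      by (intro prod.cong) auto
    also have "\<dots> = (\<Sum>\<phi>\<in>?J. C \<phi> * (\<Prod>\<nu>\<in>{1..s}. F (\<alpha> \<nu> * n + int (\<phi> \<nu>))))"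
      by (subst prod_sum_PiE) (auto simp: C_def prod.distrib)
    finally have prod: "(\<Prod>\<nu>\<in>{1..s}. F (\<alpha> \<nu> * (n + 1) + i \<nu>))
        = (\<Sum>\<phi>\<in>?J. C \<phi> * (\<Prod>\<nu>\<in>{1..s}. F (\<alpha> \<nu> * n + int (\<phi> \<nu>))))" .
    have "monomial_int F t (n + 1) = (of_int n + 1) ^ h * (\<Prod>\<nu>\<in>{1..s}. F (\<alpha> \<nu> * (n + 1) + i \<nu>))"
      unfolding i(1) monomial_int_map by simp
    also have "\<dots> = (\<Sum>l\<le>h. of_nat (h choose l) * of_int n ^ l) *
        (\<Sum>\<phi>\<in>?J. C \<phi> * (\<Prod>\<nu>\<in>{1..s}. F (\<alpha> \<nu> * n + int (\<phi> \<nu>))))"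
      unfolding prod by (simp add: binomial_ring)
    also have "\<dots> = (\<Sum>(l, \<phi>)\<in>{..h} \<times> ?J.
        (of_nat (h choose l) * C \<phi>) * monomial_int F (\<mu> l \<phi>) n)"
      unfolding sum_product sum.cartesian_product \<mu>_def monomial_int_map
      by (intro sum.cong) (auto simp: mult_ac)
    finally show "monomial_int F t (n + 1) = (\<Sum>(l, \<phi>)\<in>{..h} \<times> ?J.
        (\<lambda>n. (of_nat (h choose l) * C \<phi>) * monomial_int F (\<mu> l \<phi>) n)) n"
      by (simp add: sum_fun_apply case_prod_unfold)
  qed
  also have "\<dots> \<in> fun_space.span (monomial_int F ` S)"
  proof (rule fun_space.span_sum)
    fix x assume "x \<in> {..h} \<times> ?J"
    then obtain l \<phi> where x: "x = (l, \<phi>)" and l: "l \<in> {..h}" and \<phi>: "\<phi> \<in> ?J" by blast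
    have "\<forall>\<nu>\<in>{1..s}. 0 \<le> int (\<phi> \<nu>) \<and> int (\<phi> \<nu>) \<le> int D - 1"
      using \<phi> by (fastforce dest!: PiE_mem)
    then have "\<mu> l \<phi> \<in> monomials D l s \<alpha>"
      unfolding \<mu>_def monomials_def
      by (intro CollectI exI[of _ "\<lambda>\<nu>. int (\<phi> \<nu>)"] conjI refl)
    then have "\<mu> l \<phi> \<in> S" using S l by auto
    then show "(case x of (l, \<phi>) \<Rightarrow>
          (\<lambda>n. (of_nat (h choose l) * C \<phi>) * monomial_int F (\<mu> l \<phi>) n))
        \<in> fun_space.span (monomial_int F ` S)"
      unfolding x prod.case by (intro fun_space.span_scale fun_space.span_base imageI)
  qed
  finally show ?thesis .
qed

section \<open>The two families of the theorem\<close>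

text \<open>This is the common shape of \<open>formal_M1\<close> and \<open>formal_M2\<close>. Each
  of the two subfamilies contains all lower exponents of \<open>n\<close>, so each has a
  shift-invariant span.\<close>

lemma monomial_family_eqI:
  fixes F :: "int \<Rightarrow> complex" and p :: "complex poly"
  defines "S \<equiv> \<lambda>s \<alpha> s' \<alpha>' H.
    monomials (degree p) 0 s \<alpha> \<union> (\<Union>h\<in>{0..H}. monomials (degree p) h s' \<alpha>')"
  assumes p: "lead_coeff p = 1" "degree p > 0" "\<And>n. shift_poly p F n = 0"
    and \<alpha>: "\<And>\<nu>. \<nu> \<in> {1..s} \<Longrightarrow> \<alpha> \<nu> \<ge> 0"
    and \<alpha>': "\<And>\<nu>. \<nu> \<in> {1..s'} \<Longrightarrow> \<alpha>' \<nu> \<ge> 0"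
    and f: "f \<in> linear_combinations (monomial_fun F ` S s \<alpha> s' \<alpha>' H)"
    and g: "g \<in> linear_combinations (monomial_fun F ` S s \<alpha> s' \<alpha>' H)"
    and eq: "\<And>n. n \<in> {1..num_alg_distinct (S s \<alpha> s' \<alpha>' H)} \<Longrightarrow> f n = g n"
  shows "f n = g n"
proof (rule linear_combinations_eqI[OF _ _ f g eq])
  show "finite (S s \<alpha> s' \<alpha>' H)"
    by (simp add: S_def finite_monomials)
  fix t assume "t \<in> S s \<alpha> s' \<alpha>' H"
  then consider "t \<in> monomials (degree p) 0 s \<alpha>"
    | h where "h \<le> H" "t \<in> monomials (degree p) h s' \<alpha>'"
    by (auto simp: S_def)
  then show "(\<lambda>n. monomial_int F t (n + 1)) \<in> fun_space.span (monomial_int F ` S s \<alpha> s' \<alpha>' H)"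
  proof cases
    case 1
    show ?thesis
      using \<alpha> by (rule monomial_int_shift_in_span[OF recurrence_reduce[OF p] _ 1]) (auto simp: S_def)
  next
    case 2
    show ?thesis
      using \<alpha>' by (rule monomial_int_shift_in_span[OF recurrence_reduce[OF p] _ 2(2)])
        (use 2(1) in \<open>auto simp: S_def\<close>)
  qed
qed

theorem theorem3:
  fixes F :: "int \<Rightarrow> complex"
    and D d k \<Delta> \<beta> P Q \<gamma> :: nat
    and r :: "nat \<Rightarrow> complex" and e :: "nat \<Rightarrow> nat"
    and lam :: "nat \<Rightarrow> nat \<Rightarrow> complex"
    and a b c :: "nat \<Rightarrow> int"
  assumes roots_distinct: "inj_on r {1..d}"
    and roots_nonzero: "\<And>m. m \<in> {1..d} \<Longrightarrow> r m \<noteq> 0"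
    and mult_pos: "\<And>m. m \<in> {1..d} \<Longrightarrow> e m \<ge> 1"
    and recurrence: "linear_recurrence F D (\<Prod>m\<in>{1..d}. [:- r m, 1:] ^ e m)"
    and minimal: "\<And>D' p. linear_recurrence F D' p \<Longrightarrow> D \<le> D'"
    and closed_form: "\<And>n::int. F n =
          (\<Sum>m\<in>{1..d}. \<Sum>h<e m. lam m h * of_int n ^ h * r m powi n)"
    and a_nonneg: "\<And>i. i \<in> {1..k} \<Longrightarrow> a i \<ge> 0"
    and ab_nonneg: "\<And>i. i \<in> {1..k} \<Longrightarrow> a i + b i \<ge> 0"
    and not_both_zero: "\<And>i. i \<in> {1..k} \<Longrightarrow> \<not> (a i = 0 \<and> a i + b i = 0)"
    and Delta: "\<Delta> = Max ((\<lambda>m. e m - 1) ` {1..d})"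
    and beta: "\<beta> = 1 + \<Delta> * card {i \<in> {1..k}. a i = 0}"
    and P: "int P = (\<Sum>i\<in>{1..k}. a i + b i)"
    and Q: "int Q = (\<Sum>i\<in>{1..k}. a i)"
    and gamma: "int \<gamma> = max 0 (1 + int \<Delta> * (int k - (\<Sum>i\<in>{i \<in> {1..k}. a i > 0}. a i)))"
  shows
    "(\<forall>f \<in> linear_combinations (M1 F D k a b \<beta>).
      \<forall>g \<in> linear_combinations (M1 F D k a b \<beta>).
        (\<forall>n \<in> {1..num_alg_distinct (formal_M1 D k a b \<beta>)}. f n = g n) \<longrightarrow> (\<forall>n. f n = g n))
     \<and>
     (\<forall>f \<in> linear_combinations (M2 F D P Q \<gamma>).
      \<forall>g \<in> linear_combinations (M2 F D P Q \<gamma>).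
        (\<forall>n \<in> {1..num_alg_distinct (formal_M2 D P Q \<gamma>)}. f n = g n) \<longrightarrow> (\<forall>n. f n = g n))"
proof -
  define p where "p = (\<Prod>m\<in>{1..d}. [:- r m, 1:] ^ e m)"
  have deg: "degree p = D" and p: "lead_coeff p = 1" "degree p > 0"
    using recurrence unfolding linear_recurrence_def p_def by blast+
  \<comment> \<open>\<open>linear_recurrence\<close> gives this only for \<open>n \<ge> 0\<close>;
    at negative \<open>n\<close> it comes from the closed form.\<close>
  have ann: "shift_poly p F n = 0" for n
    unfolding p_def ext[OF closed_form]
    by (rule shift_poly_exponential_polynomial) (use roots_nonzero in simp_all)
  show ?thesis
  proof (intro conjI ballI impI)
    fix f g
    assume fg: "f \<in> linear_combinations (M1 F D k a b \<beta>)"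
      "g \<in> linear_combinations (M1 F D k a b \<beta>)"
      and eq: "\<forall>n\<in>{1..num_alg_distinct (formal_M1 D k a b \<beta>)}. f n = g n"
    show "\<forall>n. f n = g n"
    proof
      fix n
      show "f n = g n"
      proof (rule monomial_family_eqI[OF p ann, unfolded deg])
        show "f \<in> linear_combinations (monomial_fun F ` (monomials D 0 k (\<lambda>\<nu>. a \<nu> + b \<nu>) \<union>
              (\<Union>h\<in>{0..\<beta>}. monomials D h k a)))"
          using fg(1) by (simp only: M1_def formal_M1_def)
        show "g \<in> linear_combinations (monomial_fun F ` (monomials D 0 k (\<lambda>\<nu>. a \<nu> + b \<nu>) \<union>
              (\<Union>h\<in>{0..\<beta>}. monomials D h k a)))"
          using fg(2) by (simp only: M1_def formal_M1_def)
      qed (use a_nonneg ab_nonneg eq in \<open>simp_all only: formal_M1_def\<close>)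
    qed
  next
    fix f g
    assume fg: "f \<in> linear_combinations (M2 F D P Q \<gamma>)" "g \<in> linear_combinations (M2 F D P Q \<gamma>)"
      and eq: "\<forall>n\<in>{1..num_alg_distinct (formal_M2 D P Q \<gamma>)}. f n = g n"
    show "\<forall>n. f n = g n"
    proof
      fix n
      show "f n = g n"
      proof (rule monomial_family_eqI[OF p ann, unfolded deg])
        show "f \<in> linear_combinations (monomial_fun F ` (monomials D 0 P (\<lambda>\<nu>. 1) \<union>
              (\<Union>h\<in>{0..\<gamma>}. monomials D h Q (\<lambda>\<nu>. 1))))"
          using fg(1) by (simp only: M2_def formal_M2_def)
        show "g \<in> linear_combinations (monomial_fun F ` (monomials D 0 P (\<lambda>\<nu>. 1) \<union>
              (\<Union>h\<in>{0..\<gamma>}. monomials D h Q (\<lambda>\<nu>. 1))))"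
          using fg(2) by (simp only: M2_def formal_M2_def)
      qed (use eq in \<open>simp_all only: formal_M2_def zero_le_one\<close>)
    qed
  qed
qed

end
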